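(* Let $p$ be an odd prime, let $g\in\mathbb{Z}$ be a unit modulo $p$, and let $m$ be the multiplicative order of $g$ modulo $p$. Consider any $x\in\{g^{p-1+c}-p \mid 1\le c\le m\}$. Then there exists a $c'$ that solves $$g^{x-1+c'}\equiv x\pmod{p}.$$ Furthermore, this solution $c'$ is unique modulo $m$.
   Context: Here $c$ and $c'$ are integers; powers of $g$ with negative exponents are understood in $(\mathbb{Z}/p\mathbb{Z})^\times$. *)

theory Defs
  imports "HOL-Number_Theory.Number_Theory"
begin

text \<open>
  The multiplicative group of units of the integers modulo \<open>n\<close>. Its elements are the
  canonical representatives in \<open>{0..n - 1}\<close>, so they are themselves integers, and the
  library's integer exponentiation in this group interprets negative exponents.
\<close>

abbreviation unit_group_mod :: "int \<Rightarrow> int monoid" where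
  "unit_group_mod n \<equiv> units_of (residue_ring n)"

end

theory Submission
  imports Defs
begin

text \<open>Subtracting \<open>p\<close> does not change a residue, so \<open>x\<close> is congruent
  to a power \<open>g ^ n\<close>. As the exponent \<open>x - 1 + c'\<close> takes every integer
  value, \<open>c'\<close> can be chosen to make it equal to \<open>n\<close>; this gives existence,
  with \<open>unit_group_pow_nat\<close> identifying the group power with the ordinary one.
  Uniqueness holds because two powers of an element of order \<open>m\<close> agree only if their
  exponents agree modulo \<open>m\<close>.\<close>

lemma (in residues) unit_group_pow_nat:
  "a [^]\<^bsub>units_of R\<^esub> n = a ^ n mod m" for n :: nat
proof (induction n)
  case 0
  then show ?case
    by (simp add: units_of_one one_cong)
next
  case (Suc n)
  then show ?case
    by (simp add: units_of_mult res_mult_eq mod_mult_left_eq mod_mult_right_eq mult.commute)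
qed

text \<open>Units are canonical representatives between 0 and \<open>m\<close>, so each one is its
  own remainder. This turns congruences into equations in the group, where the order can be
  applied.\<close>

lemma (in residues) unit_group_congD:
  "a = b" if "[a = b] (mod m)" "a \<in> carrier (units_of R)" "b \<in> carrier (units_of R)"
  using that by (simp add: cong_def units_of_carrier res_units_eq)

theorem theorem11:
  fixes p g x :: int and m :: nat
  assumes "prime p" and "odd p"
    and "g mod p \<in> carrier (unit_group_mod p)"
    and "m = group.ord (unit_group_mod p) (g mod p)"
    and "x \<in> {g ^ nat (p - 1 + c) - p | c :: int. 1 \<le> c \<and> c \<le> int m}"
  shows "(\<exists>c' :: int. [(g mod p) [^]\<^bsub>unit_group_mod p\<^esub> (x - 1 + c') = x] (mod p)) \<and>
    (\<forall>c' c'' :: int.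
      [(g mod p) [^]\<^bsub>unit_group_mod p\<^esub> (x - 1 + c') = x] (mod p) \<longrightarrow>
      [(g mod p) [^]\<^bsub>unit_group_mod p\<^esub> (x - 1 + c'') = x] (mod p) \<longrightarrow>
      [c' = c''] (mod int m))"
proof (intro conjI allI impI)
  interpret residues p "residue_ring p"
    using prime_gt_1_int[OF assms(1)] by unfold_locales simp_all
  interpret U: group "unit_group_mod p"
    by (rule units_group)
  let ?a = "g mod p"
  obtain c where x: "x = g ^ nat (p - 1 + c) - p"
    using assms(5) by blast
  define n where "n = nat (p - 1 + c)"
  \<comment> \<open>The witness \<open>int n - x + 1\<close> cancels \<open>x - 1\<close>, leaving
    the nonnegative exponent \<open>n\<close>.\<close>
  have "?a [^]\<^bsub>unit_group_mod p\<^esub> (x - 1 + (int n - x + 1)) = ?a ^ n mod p"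
    using unit_group_pow_nat by (simp add: int_pow_int)
  then have "[?a [^]\<^bsub>unit_group_mod p\<^esub> (x - 1 + (int n - x + 1)) = x] (mod p)"
    by (simp add: x n_def cong_def power_mod)
  then show "\<exists>c'. [?a [^]\<^bsub>unit_group_mod p\<^esub> (x - 1 + c') = x] (mod p)"
    by blast
  fix c' c'' :: int
  assume "[?a [^]\<^bsub>unit_group_mod p\<^esub> (x - 1 + c') = x] (mod p)"
    and "[?a [^]\<^bsub>unit_group_mod p\<^esub> (x - 1 + c'') = x] (mod p)"
  then have "?a [^]\<^bsub>unit_group_mod p\<^esub> (x - 1 + c') = ?a [^]\<^bsub>unit_group_mod p\<^esub> (x - 1 + c'')"
    by (intro unit_group_congD U.int_pow_closed assms(3)) (auto intro: cong_trans cong_sym)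
  \<comment> \<open>The shift \<open>x - 1\<close> is common to both exponents and drops out of
    their difference.\<close>
  then have "int m dvd c'' - c'"
    using U.int_pow_eq[OF assms(3)] assms(4) by simp
  then show "[c' = c''] (mod int m)"
    by (simp add: cong_iff_dvd_diff dvd_diff_commute)
qed

end
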